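(* Fix a horizon $\eta>0$ and let $\pi$ be a policy. Suppose there is a function $v:\mathcal X\to\mathbb R$ such that either of the following holds: (1) $v$ satisfies the integral Bellman equation $$v(x)=\mathbb G_\pi^x\Big[\int_0^\eta\gamma^tR_t\,dt+\gamma^\eta v(X_\eta)\Big]\qquad\forall x\in\mathcal X;$$ (2) $v$ is $\mathrm C^1$ and satisfies the differential Bellman equation $$\alpha\, v(x)=h(x,\pi(x),\nabla v(x))\qquad\forall x\in\mathcal X.$$ Then, $\pi$ is admissible and $v=v_\pi$ if and only if $$\lim_{k\to\infty}\mathbb G_\pi^x\big[\gamma^{k\eta}\,v(X_{k\eta})\big]=0\qquad\forall x\in\mathcal X,$$ where $k$ ranges over the natural numbers.
   Context: State space $\mathcal X=\mathbb R^l$, $\mathcal X^{\mathsf T}=\mathbb R^{1\times l}$, time space $\mathbb T=[0,\infty)$. The action space $\mathcal U\subseteq\mathbb R^m$ is an $m$-dimensional manifold with or without boundary, meaning $\mathcal U=O\cup\partial O$ or $\mathcal U=O$ for some open $O\subseteq\mathbb R^m$. The environment is $\dot X_t=f(X_t,U_t)$, with $f:\mathcal X\times\mathcal U\to\mathcal X$ continuous and $t\mapsto U_t\in\mathcal U$ continuous; it is a standing assumption that the state trajectory $t\mapsto X_t$ is uniquely defined over all of $\mathbb T$ (for every initial state, in particular under every policy). A policy is a continuous function $\pi:\mathcal X\to\mathcal U$. $\mathbb G_\pi^x[Y]$ denotes the value of $Y$ when $X_0=x$ and $U_t=\pi(X_t)$ for all $t\in\mathbb T$. The reward function $r:\mathcal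 X\times\mathcal U\to\mathbb R$ is continuous, $R_t=r(X_t,U_t)$; $\gamma\in(0,1]$ is the discount factor and $\alpha=-\ln\gamma\ge0$. Standing assumption: $r$ attains a maximum $r_{\mathsf{max}}$, and $r_{\mathsf{max}}=0$ if $\gamma=1$. The value function (VF) of $\pi$ is $v_\pi(x)=\mathbb G_\pi^x[\int_0^\infty\gamma^tR_t\,dt]\in[-\infty,\infty)$. A policy $\pi$ is admissible iff $v_\pi(x)$ is finite for all $x\in\mathcal X$. Standing assumption: at least one admissible policy exists, and every admissible VF is $\mathrm C^1$. Gradients $\nabla v(x)\in\mathcal X^{\mathsf T}$ are row vectors, and the Hamiltonian is $h(x,u,p)=r(x,u)+p\,f(x,u)$ for $(x,u,p)\in\mathcal X\times\mathcal U\times\mathcal X^{\mathsf T}$. *)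

theory Defs
  imports "HOL-Analysis.Analysis"
begin

definition action_space :: "(real^'m) set \<Rightarrow> bool" where
  "action_space U \<longleftrightarrow> (\<exists>S. open S \<and> (U = S \<or> U = S \<union> frontier S))"

definition policy :: "(real^'m) set \<Rightarrow> (real^'l \<Rightarrow> real^'m) \<Rightarrow> bool" where
  "policy U \<pi> \<longleftrightarrow> continuous_on UNIV \<pi> \<and> range \<pi> \<subseteq> U"

text \<open>Actions, states and trajectories are total functions of a real time argument, but only their
  values at nonnegative times matter; the derivative at time 0 is one-sided.\<close>

definition solves ::
  "(real^'l \<Rightarrow> real^'m \<Rightarrow> real^'l) \<Rightarrow> (real \<Rightarrow> real^'m) \<Rightarrow> real^'l \<Rightarrow> (real \<Rightarrow> real^'l) \<Rightarrow> bool" where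
  "solves f u x X \<longleftrightarrow>
     X 0 = x \<and> (\<forall>t\<ge>0. (X has_vector_derivative f (X t) (u t)) (at t within {0..}))"

definition solves_policy ::
  "(real^'l \<Rightarrow> real^'m \<Rightarrow> real^'l) \<Rightarrow> (real^'l \<Rightarrow> real^'m) \<Rightarrow> real^'l \<Rightarrow> (real \<Rightarrow> real^'l) \<Rightarrow> bool" where
  "solves_policy f \<pi> x X \<longleftrightarrow> solves f (\<lambda>t. \<pi> (X t)) x X"

definition uniquely_defined :: "((real \<Rightarrow> real^'l) \<Rightarrow> bool) \<Rightarrow> bool" where
  "uniquely_defined P \<longleftrightarrow> (\<exists>X. P X \<and> (\<forall>Y. P Y \<longrightarrow> (\<forall>t\<ge>0. Y t = X t)))"

text \<open>The state at time \<open>t\<close> when starting in \<open>x\<close> and following \<open>\<pi>\<close>. The choice operator is harmless: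
  under the standing assumptions below the values at \<open>t \<ge> 0\<close> are uniquely determined.\<close>

definition state_at ::
  "(real^'l \<Rightarrow> real^'m \<Rightarrow> real^'l) \<Rightarrow> (real^'l \<Rightarrow> real^'m) \<Rightarrow> real^'l \<Rightarrow> real \<Rightarrow> real^'l" where
  "state_at f \<pi> x = (SOME X. solves_policy f \<pi> x X)"

definition reward_at ::
  "(real^'l \<Rightarrow> real^'m \<Rightarrow> real^'l) \<Rightarrow> (real^'l \<Rightarrow> real^'m \<Rightarrow> real) \<Rightarrow> (real^'l \<Rightarrow> real^'m)
     \<Rightarrow> real^'l \<Rightarrow> real \<Rightarrow> real" where
  "reward_at f r \<pi> x t = r (state_at f \<pi> x t) (\<pi> (state_at f \<pi> x t))"

text \<open>The extended-valued Lebesgue integral of \<open>g\<close> over \<open>[0,\<infinity>)\<close>: integral of the positive part minus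
  integral of the negative part (\<open>ennreal\<close> maps negative reals to 0). Under the standing assumptions
  the discounted rewards have a finite positive part, so \<open>\<infinity> - \<infinity>\<close> does not occur.\<close>

definition ext_integral :: "(real \<Rightarrow> real) \<Rightarrow> ereal" where
  "ext_integral g =
     enn2ereal (\<integral>\<^sup>+t\<in>{0..}. ennreal (g t) \<partial>lborel) - enn2ereal (\<integral>\<^sup>+t\<in>{0..}. ennreal (- g t) \<partial>lborel)"

definition value_function ::
  "(real^'l \<Rightarrow> real^'m \<Rightarrow> real^'l) \<Rightarrow> (real^'l \<Rightarrow> real^'m \<Rightarrow> real) \<Rightarrow> real \<Rightarrow> (real^'l \<Rightarrow> real^'m)
     \<Rightarrow> real^'l \<Rightarrow> ereal" where
  "value_function f r \<gamma> \<pi> x = ext_integral (\<lambda>t. \<gamma> powr t * reward_at f r \<pi> x t)"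

definition admissible ::
  "(real^'m) set \<Rightarrow> (real^'l \<Rightarrow> real^'m \<Rightarrow> real^'l) \<Rightarrow> (real^'l \<Rightarrow> real^'m \<Rightarrow> real) \<Rightarrow> real
     \<Rightarrow> (real^'l \<Rightarrow> real^'m) \<Rightarrow> bool" where
  "admissible U f r \<gamma> \<pi> \<longleftrightarrow> policy U \<pi> \<and> (\<forall>x. \<bar>value_function f r \<gamma> \<pi> x\<bar> \<noteq> \<infinity>)"

text \<open>Row vectors \<open>p\<close> are represented as elements of \<open>real^'l\<close>; the product of \<open>p\<close> with a column vector
  is the inner product.\<close>

definition gradient :: "(real^'l \<Rightarrow> real) \<Rightarrow> real^'l \<Rightarrow> real^'l" where
  "gradient v x = (THE p. GDERIV v x :> p)"

definition C1 :: "(real^'l \<Rightarrow> real) \<Rightarrow> bool" where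
  "C1 v \<longleftrightarrow> (\<forall>x. v differentiable (at x)) \<and> continuous_on UNIV (gradient v)"

definition hamiltonian ::
  "(real^'l \<Rightarrow> real^'m \<Rightarrow> real^'l) \<Rightarrow> (real^'l \<Rightarrow> real^'m \<Rightarrow> real)
     \<Rightarrow> real^'l \<Rightarrow> real^'m \<Rightarrow> real^'l \<Rightarrow> real" where
  "hamiltonian f r x u p = r x u + p \<bullet> f x u"

definition integral_bellman ::
  "(real^'l \<Rightarrow> real^'m \<Rightarrow> real^'l) \<Rightarrow> (real^'l \<Rightarrow> real^'m \<Rightarrow> real) \<Rightarrow> real \<Rightarrow> real
     \<Rightarrow> (real^'l \<Rightarrow> real^'m) \<Rightarrow> (real^'l \<Rightarrow> real) \<Rightarrow> bool" where
  "integral_bellman f r \<gamma> \<eta> \<pi> v \<longleftrightarrow>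
     (\<forall>x. v x = (LBINT t:{0..\<eta>}. \<gamma> powr t * reward_at f r \<pi> x t)
                + \<gamma> powr \<eta> * v (state_at f \<pi> x \<eta>))"

definition differential_bellman ::
  "(real^'l \<Rightarrow> real^'m \<Rightarrow> real^'l) \<Rightarrow> (real^'l \<Rightarrow> real^'m \<Rightarrow> real) \<Rightarrow> real
     \<Rightarrow> (real^'l \<Rightarrow> real^'m) \<Rightarrow> (real^'l \<Rightarrow> real) \<Rightarrow> bool" where
  "differential_bellman f r \<gamma> \<pi> v \<longleftrightarrow>
     (\<forall>x. (- ln \<gamma>) * v x = hamiltonian f r x (\<pi> x) (gradient v x))"

locale rl_problem =
  fixes U :: "(real^'m) set"
    and f :: "real^'l \<Rightarrow> real^'m \<Rightarrow> real^'l"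
    and r :: "real^'l \<Rightarrow> real^'m \<Rightarrow> real"
    and \<gamma> :: real
  assumes action_space: "action_space U"
    and f_continuous: "continuous_on (UNIV \<times> U) (\<lambda>(x, u). f x u)"
    and r_continuous: "continuous_on (UNIV \<times> U) (\<lambda>(x, u). r x u)"
    and gamma: "0 < \<gamma>" "\<gamma> \<le> 1"
    and open_loop_trajectories:
      "\<And>x u. continuous_on {0..} u \<Longrightarrow> u ` {0..} \<subseteq> U \<Longrightarrow> uniquely_defined (solves f u x)"
    and policy_trajectories:
      "\<And>x \<pi>. policy U \<pi> \<Longrightarrow> uniquely_defined (solves_policy f \<pi> x)"
    and reward_max:
      "\<exists>x\<^sub>0. \<exists>u\<^sub>0\<in>U. (\<forall>x. \<forall>u\<in>U. r x u \<le> r x\<^sub>0 u\<^sub>0) \<and> (\<gamma> = 1 \<longrightarrow> r x\<^sub>0 u\<^sub>0 = 0)"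
    and admissible_exists: "\<exists>\<pi>. admissible U f r \<gamma> \<pi>"
    and admissible_C1:
      "\<And>\<pi>. admissible U f r \<gamma> \<pi> \<Longrightarrow> C1 (\<lambda>x. real_of_ereal (value_function f r \<gamma> \<pi> x))"

end

theory Submission
  imports Defs
begin

text \<open>Iterating the Bellman equation over a horizon \<open>\<eta>\<close> gives
  \<open>v(x) = \<integral>\<^sub>0\<^bsup>k\<eta>\<^esup> \<gamma>\<^sup>t R\<^sub>t dt + \<gamma>\<^bsup>k\<eta>\<^esup> v(X\<^bsub>k\<eta>\<^esub>)\<close> for all \<open>k\<close>; the differential equation yields the
  integral one since \<open>-\<gamma>\<^sup>t R\<^sub>t\<close> is the derivative of \<open>\<gamma>\<^sup>t v(X\<^sub>t)\<close>. As the rewards are bounded above (by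
  \<open>0\<close> if \<open>\<gamma> = 1\<close>), the integrals converge to the value function in the extended reals, so \<open>v\<close> is the
  value function iff the remainder tends to \<open>0\<close>.\<close>

section \<open>Extended integrals over the half-line\<close>

text \<open>Monotone convergence applies to the positive and to the negative part separately.
  Finiteness of the positive part keeps the difference of the two limits away from
  \<open>\<infinity> - \<infinity>\<close>; the limit -\<infinity> remains possible.\<close>

lemma ext_integral_tendsto:
  fixes g :: "real \<Rightarrow> real"
  assumes g: "continuous_on {0..} g"
    and pos: "(\<integral>\<^sup>+t\<in>{0..}. ennreal (g t) \<partial>lborel) < \<infinity>"
    and T: "incseq T" "filterlim T at_top sequentially"
  shows "(\<lambda>k. ereal (LBINT t:{0..T k}. g t)) \<longlonglongrightarrow> ext_integral g"
proof -
  have lim: "(\<lambda>k. \<integral>\<^sup>+t\<in>{0..T k}. ennreal (h t) \<partial>lborel) \<longlonglongrightarrow> (\<integral>\<^sup>+t\<in>{0..}. ennreal (h t) \<partial>lborel)"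
    if h: "continuous_on {0..} h" for h :: "real \<Rightarrow> real"
  proof (rule nn_integral_LIMSEQ)
    show "incseq (\<lambda>k t. ennreal (h t) * indicator {0..T k} t)"
      using T(1) by (auto simp: incseq_def le_fun_def split: split_indicator intro: order_trans)
    show "(\<lambda>t. ennreal (h t) * indicator {0..T k} t) \<in> borel_measurable lborel" for k
    proof -
      have "(\<lambda>t. indicator {0..T k} t *\<^sub>R h t) \<in> borel_measurable borel"
        by (rule borel_measurable_continuous_on_indicator) (auto intro: continuous_on_subset[OF h])
      then have "(\<lambda>t. ennreal (indicator {0..T k} t *\<^sub>R h t)) \<in> borel_measurable lborel"
        by simp
      also have "(\<lambda>t. ennreal (indicator {0..T k} t *\<^sub>R h t)) = (\<lambda>t. ennreal (h t) * indicator {0..T k} t)"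
        by (auto split: split_indicator)
      finally show ?thesis .
    qed
    show "(\<lambda>k. ennreal (h t) * indicator {0..T k} t) \<longlonglongrightarrow> ennreal (h t) * indicator {0..} t" for t
    proof (rule tendsto_eventually)
      have "eventually (\<lambda>k. t \<le> T k) sequentially"
        using T(2) by (simp add: filterlim_at_top)
      then show "eventually (\<lambda>k. ennreal (h t) * indicator {0..T k} t
          = ennreal (h t) * indicator {0..} t) sequentially"
        by eventually_elim (auto split: split_indicator)
    qed
  qed
  \<comment> \<open>On a bounded interval the continuous function \<open>g\<close> is integrable, so
    both parts are finite and the real difference of their integrals agrees with the difference in
    \<open>ereal\<close>.\<close>
  have eq: "ereal (LBINT t:{0..s}. g t) = enn2ereal (\<integral>\<^sup>+t\<in>{0..s}. ennreal (g t) \<partial>lborel)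
      - enn2ereal (\<integral>\<^sup>+t\<in>{0..s}. ennreal (- g t) \<partial>lborel)" for s
  proof -
    let ?h = "\<lambda>t. indicator {0..s} t *\<^sub>R g t"
    have int: "integrable lborel ?h"
      using borel_integrable_atLeastAtMost'[of 0 s g] continuous_on_subset[OF g]
      by (auto simp: set_integrable_def)
    have p: "(\<integral>\<^sup>+t. ennreal (?h t) \<partial>lborel) = (\<integral>\<^sup>+t\<in>{0..s}. ennreal (g t) \<partial>lborel)"
      by (rule nn_integral_cong) (auto split: split_indicator)
    have n: "(\<integral>\<^sup>+t. ennreal (- ?h t) \<partial>lborel) = (\<integral>\<^sup>+t\<in>{0..s}. ennreal (- g t) \<partial>lborel)"
      by (rule nn_integral_cong) (auto split: split_indicator)
    have "(\<integral>\<^sup>+t. ennreal (?h t) \<partial>lborel) \<noteq> \<infinity>" "(\<integral>\<^sup>+t. ennreal (- ?h t) \<partial>lborel) \<noteq> \<infinity>"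
      using int by (simp_all add: real_integrable_def)
    then show ?thesis
      unfolding set_lebesgue_integral_def real_lebesgue_integral_def[OF int] p n
      by (cases "\<integral>\<^sup>+t\<in>{0..s}. ennreal (g t) \<partial>lborel"; cases "\<integral>\<^sup>+t\<in>{0..s}. ennreal (- g t) \<partial>lborel")
         (auto simp: enn2ereal_ennreal)
  qed
  have "enn2ereal (\<integral>\<^sup>+t\<in>{0..}. ennreal (g t) \<partial>lborel) \<noteq> \<infinity>"
    "enn2ereal (\<integral>\<^sup>+t\<in>{0..}. ennreal (g t) \<partial>lborel) \<noteq> - \<infinity>"
    using pos by (auto simp: enn2ereal_eq_top_iff)
  then show ?thesis
    unfolding ext_integral_def eq
    by (intro tendsto_diff_ereal_general)
       (auto simp: lim g continuous_on_minus)
qed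

section \<open>Gradients\<close>

text \<open>\<open>gradient\<close> is a definite description: existence comes from the Riesz vector
  \<open>p\<close> of the derivative, uniqueness from that of the derivative.\<close>

lemma differentiable_imp_GDERIV_gradient:
  fixes v :: "real^'l \<Rightarrow> real"
  assumes "v differentiable (at x)"
  shows "GDERIV v x :> gradient v x"
proof -
  obtain D where D: "(v has_derivative D) (at x)"
    using assms by (auto simp: differentiable_def)
  then interpret linear D
    by (rule has_derivative_linear)
  define p where "p = (\<Sum>b\<in>Basis. D b *\<^sub>R b)"
  have "D = (\<lambda>h. h \<bullet> p)"
  proof
    fix h
    have "D h = D (\<Sum>b\<in>Basis. (h \<bullet> b) *\<^sub>R b)"
      by (simp add: euclidean_representation)
    also have "\<dots> = h \<bullet> p"
      by (simp add: p_def sum scaleR inner_sum_right mult.commute)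
    finally show "D h = h \<bullet> p" .
  qed
  with D have p: "GDERIV v x :> p"
    by (simp add: gderiv_def)
  moreover have "q = p" if "GDERIV v x :> q" for q
  proof -
    have "(\<lambda>h. h \<bullet> q) = (\<lambda>h. h \<bullet> p)"
      using that p by (auto simp: gderiv_def intro: has_derivative_unique)
    then show ?thesis
      by (metis vector_eq_ldot)
  qed
  ultimately have "gradient v x = p"
    unfolding gradient_def by (intro the_equality)
  with p show ?thesis
    by simp
qed

section \<open>Trajectories under a fixed policy\<close>

locale rl_policy = rl_problem U f r \<gamma>
  for U :: "(real^'m) set"
    and f :: "real^'l \<Rightarrow> real^'m \<Rightarrow> real^'l"
    and r :: "real^'l \<Rightarrow> real^'m \<Rightarrow> real"
    and \<gamma> :: real +
  fixes \<pi> :: "real^'l \<Rightarrow> real^'m"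
  assumes policy: "policy U \<pi>"
begin

abbreviation state :: "real^'l \<Rightarrow> real \<Rightarrow> real^'l" where
  "state \<equiv> state_at f \<pi>"

abbreviation discounted :: "real^'l \<Rightarrow> real \<Rightarrow> real" where
  "discounted x t \<equiv> \<gamma> powr t * reward_at f r \<pi> x t"

lemma solves_state: "solves_policy f \<pi> x (state x)"
  using policy_trajectories[OF policy] unfolding state_at_def uniquely_defined_def
  by (metis someI)

lemma state_unique:
  assumes "solves_policy f \<pi> x X" "t \<ge> 0"
  shows "X t = state x t"
  using policy_trajectories[OF policy, of x] assms solves_state unfolding uniquely_defined_def
  by metis

lemma state_0: "state x 0 = x"
  using solves_state by (simp add: solves_policy_def solves_def)

lemma state_derivative:
  assumes "t \<ge> 0"
  shows "(state x has_vector_derivative f (state x t) (\<pi> (state x t))) (at t within {0..})"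
  using solves_state assms by (simp add: solves_policy_def solves_def)

lemma continuous_state: "continuous_on {0..} (state x)"
  by (rule continuous_on_vector_derivative[OF state_derivative]) simp

text \<open>The closed-loop vector field does not depend on time, so a shifted trajectory solves the
  same equation from \<open>state x s\<close>, and solutions are unique. This semigroup property
  allows a Bellman equation to be restarted at later states.\<close>

lemma state_add:
  assumes "s \<ge> 0" "t \<ge> 0"
  shows "state x (s + t) = state (state x s) t"
proof -
  have "((\<lambda>t. state x (s + t)) has_vector_derivative
      f (state x (s + t)) (\<pi> (state x (s + t)))) (at t within {0..})" if "t \<ge> 0" for t
  proof -
    have "((state x \<circ> (\<lambda>t. s + t)) has_vector_derivative
        1 *\<^sub>R f (state x (s + t)) (\<pi> (state x (s + t)))) (at t within {0..})"
    proof (rule vector_diff_chain_within)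
      show "((\<lambda>t. s + t) has_vector_derivative 1) (at t within {0..})"
        by (auto intro!: derivative_eq_intros)
      \<comment> \<open>The shift maps \<open>{0..}\<close> onto \<open>{s..}\<close>, a subset of
        \<open>{0..}\<close>, so the one-sided derivative can be restricted to it.\<close>
      show "(state x has_vector_derivative f (state x (s + t)) (\<pi> (state x (s + t))))
          (at (s + t) within (\<lambda>t. s + t) ` {0..})"
        by (rule has_vector_derivative_within_subset[OF state_derivative])
           (use \<open>s \<ge> 0\<close> that in auto)
    qed
    then show ?thesis
      by (simp add: o_def)
  qed
  then have "solves_policy f \<pi> (state x s) (\<lambda>t. state x (s + t))"
    by (simp add: solves_policy_def solves_def)
  then show ?thesis
    using state_unique[OF _ \<open>t \<ge> 0\<close>] by simp
qed

text \<open>Continuity is given only on \<open>UNIV \<times> U\<close>, and the graph of the policy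
  lies in this set.\<close>

lemma continuous_closed_loop:
  fixes g :: "real^'l \<Rightarrow> real^'m \<Rightarrow> 'a :: topological_space"
  assumes "continuous_on (UNIV \<times> U) (\<lambda>(x, u). g x u)"
  shows "continuous_on UNIV (\<lambda>x. g x (\<pi> x))"
proof -
  have "continuous_on UNIV (\<lambda>x. (\<lambda>(x, u). g x u) (x, \<pi> x))"
    using policy by (intro continuous_on_compose2[OF assms] continuous_intros) (auto simp: policy_def)
  then show ?thesis
    by simp
qed

section \<open>Discounted rewards and their integrals\<close>

lemma continuous_discounted: "continuous_on {0..} (discounted x)"
  unfolding reward_at_def using gamma
  by (intro continuous_intros continuous_on_compose2[OF continuous_closed_loop[OF r_continuous]]
      continuous_state) auto

lemma integrable_discounted:
  assumes "0 \<le> a"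
  shows "set_integrable lborel {a..b} (discounted x)"
  using assms by (intro borel_integrable_atLeastAtMost' continuous_on_subset[OF continuous_discounted]) auto

text \<open>An upper bound on the reward gives a majorant \<open>c * \<gamma> powr t\<close>. It is
  integrable for \<gamma> < 1 by exponential decay and vanishes for \<gamma> = 1, where the maximal
  reward is 0.\<close>

lemma discounted_positive_part_finite: "(\<integral>\<^sup>+t\<in>{0..}. ennreal (discounted x t) \<partial>lborel) < \<infinity>"
proof -
  obtain M where M: "\<And>x. r x (\<pi> x) \<le> M" "\<gamma> = 1 \<Longrightarrow> M = 0"
    using reward_max policy unfolding policy_def by (metis UNIV_I image_subset_iff)
  \<comment> \<open>Truncation at 0 makes the majorant nonnegative, and still gives
    \<open>c = 0\<close> when \<gamma> = 1.\<close>
  define c where "c = max 0 M"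
  have c: "0 \<le> c" and "reward_at f r \<pi> x t \<le> c" for t
    using M(1)[of "state x t"] by (auto simp: c_def reward_at_def)
  then have le: "discounted x t \<le> c * \<gamma> powr t" for t
    by (subst mult.commute) (intro mult_right_mono powr_ge_zero)
  have "(\<integral>\<^sup>+t\<in>{0..}. ennreal (discounted x t) \<partial>lborel) \<le> (\<integral>\<^sup>+t\<in>{0..}. ennreal (c * \<gamma> powr t) \<partial>lborel)"
    by (intro nn_integral_mono mult_right_mono ennreal_leI le) auto
  also have "\<dots> < \<infinity>"
  proof (cases "\<gamma> = 1")
    case True
    then show ?thesis
      using M(2) by (simp add: c_def)
  next
    case False
    then have ln: "ln \<gamma> < 0"
      using gamma by simp
    \<comment> \<open>The antiderivative \<open>c * \<gamma> powr t / ln \<gamma>\<close> tends to 0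
      at infinity because \<open>ln \<gamma> < 0\<close>.\<close>
    have "(\<integral>\<^sup>+t\<in>{0..}. ennreal (c * \<gamma> powr t) \<partial>lborel) = 0 - c * \<gamma> powr 0 / ln \<gamma>"
    proof (rule nn_integral_FTC_atLeast)
      show "(\<lambda>t. c * \<gamma> powr t) \<in> borel_measurable borel"
        by simp
      show "((\<lambda>t. c * \<gamma> powr t / ln \<gamma>) has_real_derivative c * \<gamma> powr t) (at t)" for t
        using gamma ln by (auto intro!: derivative_eq_intros)
      show "((\<lambda>t. c * \<gamma> powr t / ln \<gamma>) \<longlongrightarrow> 0) at_top"
      proof -
        have "LIM t at_top. ln \<gamma> * t :> at_bot"
          using filterlim_tendsto_neg_mult_at_bot[OF tendsto_const ln filterlim_ident] .
        then have "((\<lambda>t. exp (ln \<gamma> * t)) \<longlongrightarrow> 0) at_top"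
          by (rule filterlim_compose[OF exp_at_bot])
        then have "((\<lambda>t. \<gamma> powr t) \<longlongrightarrow> 0) at_top"
          using gamma by (simp add: powr_def mult.commute)
        then show ?thesis
          using tendsto_mult_left[of "\<lambda>t. \<gamma> powr t" 0 at_top "c / ln \<gamma>"] by simp
      qed
    qed (use c in auto)
    then show ?thesis
      by simp
  qed
  finally show ?thesis .
qed

lemma value_function_tendsto:
  assumes "incseq T" "filterlim T at_top sequentially"
  shows "(\<lambda>k. ereal (LBINT t:{0..T k}. discounted x t)) \<longlonglongrightarrow> value_function f r \<gamma> \<pi> x"
  unfolding value_function_def
  by (intro ext_integral_tendsto continuous_discounted discounted_positive_part_finite assms)

text \<open>Split the interval at \<open>s\<close> and substitute \<open>t + s\<close> in the second
  piece: the discount factors by \<open>powr_add\<close>, and \<open>state_add\<close> turns the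
  later rewards into those collected from \<open>state x s\<close>.\<close>

lemma discounted_integral_add:
  assumes "s \<ge> 0" "\<eta> \<ge> 0"
  shows "(LBINT t:{0..s + \<eta>}. discounted x t)
    = (LBINT t:{0..s}. discounted x t) + \<gamma> powr s * (LBINT t:{0..\<eta>}. discounted (state x s) t)"
proof -
  have cont: "continuous_on {a..b} (discounted x)" if "0 \<le> a" for a b x
    using that by (intro continuous_on_subset[OF continuous_discounted]) auto
  have eq: "(LBINT t:{a..b}. discounted x t) = integral {a..b} (discounted x)" if "0 \<le> a" for a b x
    using that by (intro set_borel_integral_eq_integral integrable_discounted)
  have shift: "integral {0..\<eta>} (discounted x \<circ> (\<lambda>t. t + s)) = integral {s..s + \<eta>} (discounted x)"
    using integral_shift[of 0 s \<eta> "discounted x"] cont[of s] assms by (simp add: add.commute)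
  have "integral {0..\<eta>} (discounted x \<circ> (\<lambda>t. t + s)) = integral {0..\<eta>} (\<lambda>t. \<gamma> powr s * discounted (state x s) t)"
    by (rule Henstock_Kurzweil_Integration.integral_cong)
       (use assms state_add[of s _ x] in \<open>simp add: reward_at_def powr_add add.commute\<close>)
  also have "\<dots> = \<gamma> powr s * integral {0..\<eta>} (discounted (state x s))"
    by simp
  finally have "integral {s..s + \<eta>} (discounted x) = \<gamma> powr s * integral {0..\<eta>} (discounted (state x s))"
    using shift by simp
  moreover have "integral {0..s} (discounted x) + integral {s..s + \<eta>} (discounted x)
      = integral {0..s + \<eta>} (discounted x)"
    using assms
    by (intro Henstock_Kurzweil_Integration.integral_combine integrable_continuous_interval cont) auto
  ultimately show ?thesis
    using assms by (simp add: eq)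
qed

section \<open>Bellman equations\<close>

lemma differential_imp_integral_bellman:
  assumes "C1 v" "differential_bellman f r \<gamma> \<pi> v" "\<eta> \<ge> 0"
  shows "integral_bellman f r \<gamma> \<eta> \<pi> v"
  unfolding integral_bellman_def
proof
  fix x
  \<comment> \<open>The sign makes \<open>?F\<close> an antiderivative of the discounted reward
    itself.\<close>
  let ?F = "\<lambda>t. - (\<gamma> powr t * v (state x t))"
  have deriv: "(?F has_vector_derivative discounted x t) (at t within {0..\<eta>})" if "0 \<le> t" for t
  proof -
    let ?X = "state x t"
    have "(v has_derivative (\<lambda>h. h \<bullet> gradient v ?X)) (at ?X within state x ` {0..})"
      using differentiable_imp_GDERIV_gradient[of v ?X] \<open>C1 v\<close>
      by (auto simp: C1_def gderiv_def intro: has_derivative_at_withinI)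
    then have "((v \<circ> state x) has_vector_derivative f ?X (\<pi> ?X) \<bullet> gradient v ?X) (at t within {0..})"
      by (rule vector_derivative_diff_chain_within[OF state_derivative[OF that]])
    then have vX: "((\<lambda>t. v (state x t)) has_real_derivative gradient v ?X \<bullet> f ?X (\<pi> ?X)) (at t within {0..})"
      by (simp add: o_def has_real_derivative_iff_has_vector_derivative inner_commute)
    have "(?F has_real_derivative discounted x t) (at t within {0..})"
    proof -
      \<comment> \<open>The differential equation solved for the derivative of \<open>v\<close>
        along the trajectory; its term \<open>- ln \<gamma> * v ?X\<close> cancels the one that the
        product rule produces from \<open>\<gamma> powr t\<close>.\<close>
      have bellman: "gradient v ?X \<bullet> f ?X (\<pi> ?X) = - ln \<gamma> * v ?X - reward_at f r \<pi> x t"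
        using assms(2) by (simp add: differential_bellman_def hamiltonian_def reward_at_def)
      have "((\<lambda>t. \<gamma> powr t) has_real_derivative \<gamma> powr t * ln \<gamma>) (at t within {0..})"
        by (rule has_field_derivative_at_within) (use gamma in \<open>auto intro!: derivative_eq_intros\<close>)
      from DERIV_minus[OF DERIV_mult[OF this vX]] show ?thesis
        by (simp add: bellman algebra_simps)
    qed
    then show ?thesis
      unfolding has_real_derivative_iff_has_vector_derivative
      by (rule has_vector_derivative_within_subset) simp
  qed
  have "(LBINT t:{0..\<eta>}. discounted x t) = ?F \<eta> - ?F 0"
    unfolding set_lebesgue_integral_def
    by (intro integral_FTC_atLeastAtMost[OF \<open>\<eta> \<ge> 0\<close> deriv] continuous_on_subset[OF continuous_discounted]) auto
  then show "v x = (LBINT t:{0..\<eta>}. discounted x t) + \<gamma> powr \<eta> * v (state x \<eta>)"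
    using gamma by (simp add: state_0)
qed

text \<open>In the induction step, the Bellman equation at the state reached after \<open>k\<close>
  horizons, scaled by the discount accumulated so far, replaces the remainder and extends the
  integral by one horizon.\<close>

lemma integral_bellman_iterate:
  assumes "integral_bellman f r \<gamma> \<eta> \<pi> v" "\<eta> \<ge> 0"
  shows "v x = (LBINT t:{0..real k * \<eta>}. discounted x t)
    + \<gamma> powr (real k * \<eta>) * v (state x (real k * \<eta>))"
proof (induction k)
  case 0
  show ?case
    using gamma set_borel_integral_eq_integral(2)[OF integrable_discounted[of 0 0 x]] by (simp add: state_0)
next
  case (Suc k)
  let ?s = "real k * \<eta>" and ?y = "state x (real k * \<eta>)"
  have s: "?s \<ge> 0" and Suc_s: "real (Suc k) * \<eta> = ?s + \<eta>"
    using \<open>\<eta> \<ge> 0\<close> by (auto simp: algebra_simps)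
  have "v ?y = (LBINT t:{0..\<eta>}. discounted ?y t) + \<gamma> powr \<eta> * v (state ?y \<eta>)"
    using assms(1) unfolding integral_bellman_def by blast
  then have "\<gamma> powr ?s * v ?y
      = \<gamma> powr ?s * (LBINT t:{0..\<eta>}. discounted ?y t) + \<gamma> powr (?s + \<eta>) * v (state x (?s + \<eta>))"
    unfolding state_add[OF s \<open>\<eta> \<ge> 0\<close>] powr_add by (simp add: algebra_simps)
  with Suc.IH show ?case
    unfolding Suc_s discounted_integral_add[OF s \<open>\<eta> \<ge> 0\<close>] by linarith
qed

text \<open>The comparison takes place in \<open>ereal\<close>, where the partial integrals always
  have a limit, possibly -\<infinity>. Partial integral and remainder add up to the constant
  \<open>v x\<close>, so the former tends to \<open>v x\<close> exactly when the latter tends to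
  0.\<close>

lemma value_function_eq_iff:
  assumes "integral_bellman f r \<gamma> \<eta> \<pi> v" "\<eta> > 0"
  shows "ereal (v x) = value_function f r \<gamma> \<pi> x \<longleftrightarrow>
    (\<lambda>k::nat. \<gamma> powr (real k * \<eta>) * v (state x (real k * \<eta>))) \<longlonglongrightarrow> 0"
    (is "_ \<longleftrightarrow> ?a \<longlonglongrightarrow> 0")
proof -
  let ?S = "\<lambda>k. LBINT t:{0..real k * \<eta>}. discounted x t"
  have S: "?S = (\<lambda>k. v x - ?a k)" and a: "?a = (\<lambda>k. v x - ?S k)"
    using integral_bellman_iterate[OF assms(1), of x] \<open>\<eta> > 0\<close> by (simp_all add: fun_eq_iff algebra_simps)
  have "incseq (\<lambda>k. real k * \<eta>)" "filterlim (\<lambda>k. real k * \<eta>) at_top sequentially"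
    using \<open>\<eta> > 0\<close>
    by (auto simp: incseq_def intro: mult_right_mono filterlim_at_top_mult_tendsto_pos[OF tendsto_const]
        filterlim_real_sequentially)
  then have lim: "(\<lambda>k. ereal (?S k)) \<longlonglongrightarrow> value_function f r \<gamma> \<pi> x"
    by (rule value_function_tendsto)
  show ?thesis
  proof
    assume "ereal (v x) = value_function f r \<gamma> \<pi> x"
    then have "(\<lambda>k. ereal (?S k)) \<longlonglongrightarrow> ereal (v x)"
      using lim by simp
    then have "?S \<longlonglongrightarrow> v x"
      by simp
    then show "?a \<longlonglongrightarrow> 0"
      using tendsto_diff[OF tendsto_const[of "v x"], of ?S "v x"] by (subst a) simp
  next
    assume "?a \<longlonglongrightarrow> 0"
    then have "?S \<longlonglongrightarrow> v x"
      using tendsto_diff[OF tendsto_const[of "v x"], of ?a 0] by (subst S) simp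
    then have "(\<lambda>k. ereal (?S k)) \<longlonglongrightarrow> ereal (v x)"
      by simp
    then show "ereal (v x) = value_function f r \<gamma> \<pi> x"
      using lim by (rule LIMSEQ_unique)
  qed
qed

end

section \<open>The equivalence under either Bellman equation\<close>

theorem theorem2p5:
  fixes U :: "(real^'m) set"
    and f :: "real^'l \<Rightarrow> real^'m \<Rightarrow> real^'l"
    and r :: "real^'l \<Rightarrow> real^'m \<Rightarrow> real"
    and \<gamma> \<eta> :: real
    and \<pi> :: "real^'l \<Rightarrow> real^'m"
    and v :: "real^'l \<Rightarrow> real"
  assumes "rl_problem U f r \<gamma>"
    and "\<eta> > 0"
    and "policy U \<pi>"
    and "integral_bellman f r \<gamma> \<eta> \<pi> v \<or> (C1 v \<and> differential_bellman f r \<gamma> \<pi> v)"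
  shows "(admissible U f r \<gamma> \<pi> \<and> (\<forall>x. ereal (v x) = value_function f r \<gamma> \<pi> x)) \<longleftrightarrow>
    (\<forall>x. (\<lambda>k::nat. \<gamma> powr (real k * \<eta>) * v (state_at f \<pi> x (real k * \<eta>))) \<longlonglongrightarrow> 0)"
proof -
  interpret rl_policy U f r \<gamma> \<pi>
    using assms by (simp add: rl_policy_def rl_policy_axioms_def)
  have "integral_bellman f r \<gamma> \<eta> \<pi> v"
    using assms(2,4) differential_imp_integral_bellman by auto
  note iff = value_function_eq_iff[OF this \<open>\<eta> > 0\<close>, symmetric]
  \<comment> \<open>A value function equal to the real-valued \<open>v\<close> is finite everywhere,
    so admissibility follows from the equality and the pointwise equivalence suffices.\<close>
  have "admissible U f r \<gamma> \<pi>" if "\<forall>x. ereal (v x) = value_function f r \<gamma> \<pi> x"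
    using that policy by (auto simp: admissible_def simp flip: that[rule_format])
  then show ?thesis
    unfolding iff by blast
qed

end
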